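(* Let $n\ge1$ and define $\phi:\mathcal{B}_{2n}\to\mathcal{B}_{2n}$ as follows. Given $p\in\mathcal{B}_{2n}$, let $s=(s_1,\dots,s_{2n})$ be its word, with $s_j$ an arrow if the $j$-th step is an up-step and a blank if it is a down-step. Let $s_{NW}$ be the length-$n$ sequence obtained from $(s_1,s_3,\dots,s_{2n-1})$ by replacing every arrow by a blank and every blank by an arrow, and let $s_{SW}=(s_2,s_4,\dots,s_{2n-2})$ (the even-indexed entries with the last one removed). Then $(s_{NW},s_{SW})$ is a checkmark pair, and $\phi(p)$ is defined to be the unique path in $\mathcal{B}_{2n}$ whose checkmark representation is $(s_{NW},s_{SW})$. Then $\phi$ is a bijection. Furthermore, if $p$ has bi-banded weight $w(p)=a^{2n-2v}b^{2v}$, then $\phi(p)$ has peak-counting weight $\widehat{w}(\phi(p))=m^{v+1}$.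
   Context: A path of length $t$ is a sequence of vertices $v_0,\dots,v_t$ in $\mathbb{Z}^2$ with $v_0=(0,0)$, $v_t=(t,0)$ and each step $v_j-v_{j-1}\in\{(1,1),(1,-1)\}$ (up-step / down-step). $\mathcal{B}_{2n}$ is the set of all such paths of length $2n$ with vertices in $\mathbb{Z}_{\ge0}\times\mathbb{Z}$. A right turn of $p$ is a vertex $v_i$ ($0\le i<2n$) at which an up-step is followed by a down-step, where $v_0$ counts as a right turn iff the first step is a down-step; a left turn is a vertex $v_i$ ($0<i<2n$) at which a down-step is followed by an up-step. The checkmark representation of $p\in\mathcal{B}_{2n}$ is the pair $(s_{NW},s_{SW})$ of arrow/blank sequences of lengths $n$ and $n-1$ where the $h$-th entry of $s_{NW}$ ($1\le h\le n$) is an arrow iff $p$ has a right turn at a vertex $(i,y)$ with $i+y=2(h-1)$, and the $j$-th entry of $s_{SW}$ ($1\le j\le n-1$) is an arrow iff $p$ has a left turn at a vertex $(i,y)$ with $i-y=2j$. A checkmark pair is a pair of such sequences in which the number of arrows of $s_{NW}$ equals or exceeds by one that of $s_{SW}$; every checkmark pair is the checkmark representation of exactly one path in $\mathcal{B}_{2n}$. Bi-banded weight: an up-step from an even height to an odd height, and a down-step from an odd height to an even height, get weight $a$; every other step gets weight $b$; $w(p)$ is the product of the step weights. Peak-counting weight: a peak is a vertex $v_i$ with $0<i<2n$ preceded by an up-step and followed by a down-step; additionally $v_0$ is a peak iff the first step is a down-step, and $v_{2n}$ is a peak iff the last step is an up-step; $\widehat{w}(p)=m^{\#\text{peaks of }p}$.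 *)

theory Defs
  imports "HOL-Library.Product_Plus" "HOL-Computational_Algebra.Polynomial"
begin

text \<open>A path is the list of its vertices, so the vertex $v_i$ is \<open>p ! i\<close>.\<close>

definition is_path :: "nat \<Rightarrow> (int \<times> int) list \<Rightarrow> bool" where
  "is_path t p \<longleftrightarrow> length p = t + 1 \<and> p ! 0 = (0, 0) \<and> p ! t = (int t, 0) \<and>
     (\<forall>j\<in>{1..t}. p ! j - p ! (j - 1) \<in> {(1, 1), (1, -1)})"

definition \<B> :: "nat \<Rightarrow> (int \<times> int) list set" where
  "\<B> t = {p. is_path t p \<and> (\<forall>v\<in>set p. fst v \<ge> 0)}"

text \<open>Steps are numbered from 1: the \<open>j\<close>-th step leads from $v_{j-1}$ to $v_j$.\<close>

definition up_step :: "(int \<times> int) list \<Rightarrow> nat \<Rightarrow> bool" where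
  "up_step p j \<longleftrightarrow> p ! j - p ! (j - 1) = (1, 1)"

definition down_step :: "(int \<times> int) list \<Rightarrow> nat \<Rightarrow> bool" where
  "down_step p j \<longleftrightarrow> p ! j - p ! (j - 1) = (1, -1)"

definition right_turn :: "nat \<Rightarrow> (int \<times> int) list \<Rightarrow> nat \<Rightarrow> bool" where
  "right_turn n p i \<longleftrightarrow> i < 2 * n \<and>
     (if i = 0 then down_step p 1 else up_step p i \<and> down_step p (i + 1))"

definition left_turn :: "nat \<Rightarrow> (int \<times> int) list \<Rightarrow> nat \<Rightarrow> bool" where
  "left_turn n p i \<longleftrightarrow> 0 < i \<and> i < 2 * n \<and> down_step p i \<and> up_step p (i + 1)"

datatype mark = Arrow | Blank

fun swap_mark :: "mark \<Rightarrow> mark" where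
  "swap_mark Arrow = Blank"
| "swap_mark Blank = Arrow"

definition checkmark_rep :: "nat \<Rightarrow> (int \<times> int) list \<Rightarrow> mark list \<times> mark list" where
  "checkmark_rep n p =
     (map (\<lambda>h. if \<exists>i. right_turn n p i \<and> fst (p ! i) + snd (p ! i) = 2 * (int h - 1)
               then Arrow else Blank) [1..<n + 1],
      map (\<lambda>j. if \<exists>i. left_turn n p i \<and> fst (p ! i) - snd (p ! i) = 2 * int j
               then Arrow else Blank) [1..<n])"

definition checkmark_pair :: "nat \<Rightarrow> mark list \<times> mark list \<Rightarrow> bool" where
  "checkmark_pair n s \<longleftrightarrow> length (fst s) = n \<and> length (snd s) = n - 1 \<and>
     (count_list (fst s) Arrow = count_list (snd s) Arrow \<or>
      count_list (fst s) Arrow = count_list (snd s) Arrow + 1)"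

definition path_word :: "nat \<Rightarrow> (int \<times> int) list \<Rightarrow> mark list" where
  "path_word n p = map (\<lambda>j. if up_step p j then Arrow else Blank) [1..<2 * n + 1]"

text \<open>With 0-based list indices, $s_{2h-1}$ is \<open>s ! (2 * h - 2)\<close> and $s_{2j}$ is
  \<open>s ! (2 * j - 1)\<close>.\<close>

definition phi_pair :: "nat \<Rightarrow> (int \<times> int) list \<Rightarrow> mark list \<times> mark list" where
  "phi_pair n p = (let s = path_word n p in
     (map (\<lambda>h. swap_mark (s ! (2 * h - 2))) [1..<n + 1],
      map (\<lambda>j. s ! (2 * j - 1)) [1..<n]))"

definition phi :: "nat \<Rightarrow> (int \<times> int) list \<Rightarrow> (int \<times> int) list" where
  "phi n p = (THE q. q \<in> \<B> (2 * n) \<and> checkmark_rep n q = phi_pair n p)"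

definition step_weight :: "'r::comm_semiring_1 \<Rightarrow> 'r \<Rightarrow> (int \<times> int) list \<Rightarrow> nat \<Rightarrow> 'r" where
  "step_weight a b p j =
     (if up_step p j \<and> even (snd (p ! (j - 1))) \<and> odd (snd (p ! j)) \<or>
         down_step p j \<and> odd (snd (p ! (j - 1))) \<and> even (snd (p ! j))
      then a else b)"

definition bibanded_weight :: "'r::comm_semiring_1 \<Rightarrow> 'r \<Rightarrow> nat \<Rightarrow> (int \<times> int) list \<Rightarrow> 'r" where
  "bibanded_weight a b n p = (\<Prod>j = 1..2 * n. step_weight a b p j)"

definition is_peak :: "nat \<Rightarrow> (int \<times> int) list \<Rightarrow> nat \<Rightarrow> bool" where
  "is_peak n p i \<longleftrightarrow>
     0 < i \<and> i < 2 * n \<and> up_step p i \<and> down_step p (i + 1) \<or>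
     i = 0 \<and> down_step p 1 \<or>
     i = 2 * n \<and> up_step p (2 * n)"

definition peak_weight :: "'r::comm_semiring_1 \<Rightarrow> nat \<Rightarrow> (int \<times> int) list \<Rightarrow> 'r" where
  "peak_weight m n p = m ^ card {i. is_peak n p i}"

text \<open>The weights are formal: \<open>a\<close> and \<open>b\<close> are the two indeterminates of
  $\mathbf{Z}[a][b]$, and \<open>m\<close> is the indeterminate of $\mathbf{Z}[m]$. For arbitrary ring elements
  the value of \<open>w(p)\<close> would not determine the exponent \<open>v\<close>.\<close>

definition var_a :: "int poly poly" where "var_a = [:[:0, 1:]:]"

definition var_b :: "int poly poly" where "var_b = [:0, 1:]"

definition var_m :: "int poly" where "var_m = [:0, 1:]"

end

theory Submission
  imports Defs
begin

text \<open>
  Read a path as a balanced word in up- and down-steps. A right turn with \<open>u\<close> up-steps before it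
  exists iff some down-step has exactly \<open>u\<close> up-steps before it, and symmetrically for left turns, so
  the checkmark representation records the levels \<open>< n\<close> at which down-steps occur and the levels
  in \<open>{1..<n}\<close> at which up-steps occur. These levels determine the word letter by letter, and their
  numbers differ by at most one because up- and down-runs alternate; hence taking the checkmark
  representation is injective into the checkmark pairs. Splitting a balanced word into its odd and
  even letters is a bijection onto the same finite set, since the omitted last letter is forced by
  balance. So both maps are bijections, and the path map is
  the second followed by the inverse of the first.

  The number of steps of weight \<open>b\<close> is the number of odd down-steps plus the number of even
  up-steps; balance makes these two equal, so each is \<open>v\<close>, the number of arrows in the first
  sequence. The peaks of the image lie at the levels of these arrows together with level \<open>n\<close>.
\<close>

text \<open>Sums of \<open>of_bool\<close> stay sums so that they can be split by parity; the rule
  is invoked by name where cardinalities are wanted.\<close>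

declare sum_of_bool_eq [simp del]

definition bits :: "nat \<Rightarrow> (int \<times> int) list \<Rightarrow> bool list" where
  "bits n p = map (up_step p) [1..<2 * n + 1]"

definition balanced :: "nat \<Rightarrow> bool list set" where
  "balanced n = {w. length w = 2 * n \<and> count_list w True = n}"

text \<open>The height after \<open>i\<close> steps is ups minus downs, hence twice the ups minus
  \<open>i\<close>.\<close>

definition path_of :: "bool list \<Rightarrow> (int \<times> int) list" where
  "path_of w = map (\<lambda>i. (int i, 2 * int (count_list (take i w) True) - int i)) [0..<length w + 1]"

text \<open>The numbers of up-steps preceding the individual down-steps.\<close>

fun down_levels :: "bool list \<Rightarrow> nat set" where
  "down_levels [] = {}"
| "down_levels (x # w) = (if x then Suc ` down_levels w else insert 0 (down_levels w))"

abbreviation up_levels :: "bool list \<Rightarrow> nat set" where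
  "up_levels w \<equiv> down_levels (map Not w)"

section \<open>Counting letters and splitting sums by parity\<close>

lemma count_list_take_Suc:
  "i < length w \<Longrightarrow> count_list (take (Suc i) w) x = count_list (take i w) x + of_bool (w ! i = x)"
  by (simp add: take_Suc_conv_app_nth)

lemma count_list_conv_sum: "count_list w x = (\<Sum>i<length w. of_bool (w ! i = x))"
proof -
  have "i \<le> length w \<Longrightarrow> count_list (take i w) x = (\<Sum>j<i. of_bool (w ! j = x))" for i
    by (induction i) (auto simp: count_list_take_Suc)
  from this[of "length w"] show ?thesis by simp
qed

lemma count_list_True_False: "count_list w True + count_list w False = length w"
  by (induction w) auto

lemma count_list_map_Not: "count_list (map Not w) x = count_list w (\<not> x)"
  by (induction w) auto

lemma count_list_upt_sum:
  "count_list (map f [a..<b]) x = (\<Sum>i\<in>{a..<b}. of_bool (f i = x))"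
proof -
  have "count_list (map f xs) x = sum_list (map (\<lambda>i. of_bool (f i = x)) xs)" for xs :: "nat list"
    by (induction xs) auto
  then show ?thesis by (simp add: interv_sum_list_conv_sum_set_nat)
qed

lemma sum_lessThan_double:
  fixes f :: "nat \<Rightarrow> 'a::comm_monoid_add"
  shows "(\<Sum>i<2 * n. f i) = (\<Sum>h<n. f (2 * h)) + (\<Sum>h<n. f (Suc (2 * h)))"
  by (induction n) (simp_all add: add_ac)

lemma sum_of_bool_add_Not: "(\<Sum>h<n. of_bool (P h)) + (\<Sum>h<n. of_bool (\<not> P h)) = (n :: nat)"
  by (induction n) auto

section \<open>Paths and words\<close>

lemma length_bits [simp]: "length (bits n p) = 2 * n"
  by (simp add: bits_def)

lemma nth_bits: "i < 2 * n \<Longrightarrow> bits n p ! i = up_step p (Suc i)"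
  by (simp add: bits_def nth_upt del: upt_Suc)

lemma down_step_bits:
  assumes "p \<in> \<B> (2 * n)" "i < 2 * n"
  shows "down_step p (Suc i) \<longleftrightarrow> \<not> bits n p ! i"
proof -
  have "Suc i \<in> {1..2 * n}" using assms by simp
  then have "p ! Suc i - p ! (Suc i - 1) \<in> {(1, 1), (1, -1)}"
    using assms unfolding \<B>_def is_path_def by blast
  then show ?thesis
    using assms by (auto simp: nth_bits up_step_def down_step_def)
qed

text \<open>Induction along the path. It makes x + y twice the number of earlier up-steps and x - y
  twice that of earlier down-steps, so the diagonals of the checkmark representation become
  levels.\<close>

lemma path_nth:
  assumes "p \<in> \<B> (2 * n)" "i \<le> 2 * n"
  shows "p ! i = (int i, 2 * int (count_list (take i (bits n p)) True) - int i)"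
  using assms(2)
proof (induction i)
  case 0
  then show ?case using assms(1) by (simp add: \<B>_def is_path_def)
next
  case (Suc i)
  then have IH: "p ! i = (int i, 2 * int (count_list (take i (bits n p)) True) - int i)" and i: "i < 2 * n"
    by simp_all
  have "p ! Suc i - p ! i = (1, if bits n p ! i then 1 else -1)"
    using down_step_bits[OF assms(1) i] nth_bits[OF i, of p]
    by (auto simp: up_step_def down_step_def)
  then have "p ! Suc i = p ! i + (1, if bits n p ! i then 1 else -1)"
    by (metis add.commute diff_add_cancel)
  then show ?case
    using i by (auto simp: IH count_list_take_Suc)
qed

lemma bits_balanced:
  assumes "p \<in> \<B> (2 * n)"
  shows "bits n p \<in> balanced n"
proof -
  have "p ! (2 * n) = (int (2 * n), 0)"
    using assms by (simp add: \<B>_def is_path_def)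
  then show ?thesis
    using path_nth[OF assms, of "2 * n"] by (simp add: balanced_def)
qed

lemma path_of_bits:
  assumes "p \<in> \<B> (2 * n)"
  shows "path_of (bits n p) = p"
proof (rule nth_equalityI)
  show "length (path_of (bits n p)) = length p"
    using assms by (simp add: path_of_def \<B>_def is_path_def)
next
  fix i assume "i < length (path_of (bits n p))"
  then have "i < 2 * n + 1" by (simp add: path_of_def)
  then show "path_of (bits n p) ! i = p ! i"
    using path_nth[OF assms, of i] by (simp add: path_of_def del: upt_Suc)
qed

lemma nth_path_of:
  "i \<le> length w \<Longrightarrow> path_of w ! i = (int i, 2 * int (count_list (take i w) True) - int i)"
  by (simp add: path_of_def del: upt_Suc)

lemma path_of_step:
  "i < length w \<Longrightarrow> path_of w ! Suc i - path_of w ! i = (1, if w ! i then 1 else -1)"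
  by (simp add: nth_path_of count_list_take_Suc)

lemma path_of_in_B:
  assumes "w \<in> balanced n"
  shows "path_of w \<in> \<B> (2 * n)"
proof -
  have l: "length w = 2 * n" and c: "count_list w True = n"
    using assms by (auto simp: balanced_def)
  have "path_of w ! j - path_of w ! (j - 1) \<in> {(1, 1), (1, -1)}" if "j \<in> {1..2 * n}" for j
    using path_of_step[of "j - 1" w] that l by (cases j) auto
  moreover have "path_of w ! 0 = (0, 0)" "path_of w ! (2 * n) = (int (2 * n), 0)"
    using l c by (simp_all add: nth_path_of)
  moreover have "length (path_of w) = 2 * n + 1" "\<forall>v\<in>set (path_of w). fst v \<ge> 0"
    using l by (auto simp: path_of_def)
  ultimately show ?thesis
    unfolding \<B>_def is_path_def by blast
qed

lemma bits_path_of: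
  assumes "w \<in> balanced n"
  shows "bits n (path_of w) = w"
proof (rule nth_equalityI)
  show "length (bits n (path_of w)) = length w"
    using assms by (simp add: balanced_def)
next
  fix i assume "i < length (bits n (path_of w))"
  then have "i < 2 * n" by simp
  then show "bits n (path_of w) ! i = w ! i"
    using path_of_step[of i w] assms by (simp add: nth_bits up_step_def balanced_def)
qed

lemma bij_betw_bits: "bij_betw (bits n) (\<B> (2 * n)) (balanced n)"
  by (rule bij_betw_byWitness[where f' = path_of])
    (auto simp: path_of_bits bits_path_of bits_balanced path_of_in_B)

lemma finite_balanced: "finite (balanced n)"
proof (rule finite_subset)
  show "balanced n \<subseteq> {w. set w \<subseteq> UNIV \<and> length w = 2 * n}"
    by (auto simp: balanced_def)
qed (rule finite_lists_length_eq, simp)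

section \<open>The levels at which steps occur\<close>

lemma down_levels_iff:
  "u \<in> down_levels w \<longleftrightarrow> (\<exists>i<length w. \<not> w ! i \<and> count_list (take i w) True = u)"
  by (induction w arbitrary: u) (auto simp: Ex_less_Suc2 image_iff)

text \<open>Moving back along a run of down-steps leaves the number of earlier up-steps unchanged,
  so the first down-step at a level starts the word or follows an up-step.\<close>

lemma down_levels_turn_iff:
  "u \<in> down_levels w \<longleftrightarrow>
    (\<exists>i<length w. \<not> w ! i \<and> (i = 0 \<or> w ! (i - 1)) \<and> count_list (take i w) True = u)"
proof
  assume "u \<in> down_levels w"
  define P where "P i \<longleftrightarrow> i < length w \<and> \<not> w ! i \<and> count_list (take i w) True = u" for i
  have "\<exists>i. P i"
    using \<open>u \<in> down_levels w\<close> by (auto simp: down_levels_iff P_def)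
  then obtain i where i: "P i" and least: "\<And>j. j < i \<Longrightarrow> \<not> P j"
    by (metis exists_least_iff)
  have "w ! j" if "i = Suc j" for j
    using i least[of j] that by (auto simp: P_def count_list_take_Suc)
  then have "i = 0 \<or> w ! (i - 1)"
    by (cases i) auto
  then show "\<exists>i<length w. \<not> w ! i \<and> (i = 0 \<or> w ! (i - 1)) \<and> count_list (take i w) True = u"
    using i by (auto simp: P_def)
qed (auto simp: down_levels_iff)

lemma zero_in_down_levels: "0 \<in> down_levels w \<longleftrightarrow> w \<noteq> [] \<and> \<not> hd w"
  by (cases w) auto

text \<open>Settles whether the top level, absent from the checkmark sequences, is occupied: a
  down-step preceded by every up-step must lie in the final run.\<close>

lemma count_in_down_levels: "count_list w True \<in> down_levels w \<longleftrightarrow> w \<noteq> [] \<and> \<not> last w"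
proof (induction w)
  case (Cons x w)
  have "count_list w True \<noteq> 0" if "w \<noteq> []" "last w"
    using that by (metis count_list_0_iff last_in_set)
  then show ?case using Cons by (cases "w = []") auto
qed simp

lemma count_in_up_levels: "count_list w False \<in> up_levels w \<longleftrightarrow> w \<noteq> [] \<and> last w"
  using count_in_down_levels[of "map Not w"] by (auto simp: count_list_map_Not last_map)

lemma down_levels_le: "u \<in> down_levels w \<Longrightarrow> u \<le> count_list w True"
  by (induction w arbitrary: u) (auto split: if_splits)

lemma finite_down_levels [simp]: "finite (down_levels w)"
  by (induction w) auto

text \<open>Down-runs and the up-runs following them alternate, so their numbers differ by at most one.\<close>

lemma card_down_levels:
  "card (down_levels w) = card (up_levels w - {0}) + of_bool (w \<noteq> [] \<and> \<not> last w)"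
proof (induction w)
  case (Cons x w)
  show ?case
  proof (cases x)
    case True
    then show ?thesis using Cons by (auto simp: card_image)
  next
    case False
    have "Suc ` up_levels w - {0} = Suc ` up_levels w" by auto
    then have "card (up_levels (x # w) - {0}) = card (up_levels w)"
      using False by (simp add: card_image)
    also have "\<dots> = card (up_levels w - {0}) + of_bool (0 \<in> up_levels w)"
      using card_Suc_Diff1[of "up_levels w" 0] by auto
    finally have up: "card (up_levels (x # w) - {0}) = \<dots>" .
    have "card (down_levels (x # w)) = card (down_levels w) + of_bool (0 \<notin> down_levels w)"
      using False by (simp add: card_insert_if)
    moreover have "0 \<in> up_levels w \<longleftrightarrow> w \<noteq> [] \<and> 0 \<notin> down_levels w"
      by (cases w) auto
    ultimately show ?thesis
      unfolding up Cons.IH using False by (cases "w = []") auto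
  qed
qed simp

text \<open>Level 0 reveals the first letter, and deleting that letter shifts the levels of the
  opposite steps by one; induction then treats the rest.\<close>

lemma levels_determine_word:
  assumes "count_list w True = count_list w' True" "count_list w False = count_list w' False"
    and "\<And>u. u < count_list w True \<Longrightarrow> u \<in> down_levels w \<longleftrightarrow> u \<in> down_levels w'"
    and "\<And>u. u < count_list w False \<Longrightarrow> u \<in> up_levels w \<longleftrightarrow> u \<in> up_levels w'"
  shows "w = w'"
  using assms
proof (induction w arbitrary: w')
  case Nil
  then show ?case using count_list_True_False[of w'] by simp
next
  case (Cons x w)
  have "length w' = length (x # w)"
    using Cons.prems(1,2) count_list_True_False[of w'] count_list_True_False[of "x # w"] by linarith
  then obtain y v where w': "w' = y # v" by (cases w') auto
  have "x = y"
    using Cons.prems(1,2) Cons.prems(3,4)[of 0] by (auto simp: w' split: if_splits)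
  have len: "length v = length w" using \<open>length w' = length (x # w)\<close> w' by simp
  have cT: "count_list w True = count_list v True" and cF: "count_list w False = count_list v False"
    using Cons.prems(1,2) by (auto simp: w' \<open>x = y\<close> split: if_splits)
  have hd_count: "u \<noteq> [] \<and> hd u = b \<Longrightarrow> count_list u b > 0" for u :: "bool list" and b
    by (cases u) auto
  \<comment> \<open>The deleted letter masks level 0 of its own kind in the rest, so the next letter
    is read from the shifted levels of the other kind. If the bound on these is 0, both tails lack
    the deleted letter.\<close>
  have hd: "hd w = hd v" if "w \<noteq> []" "v \<noteq> []"
  proof (cases x)
    case True
    have "u \<in> down_levels w \<longleftrightarrow> u \<in> down_levels v" if "u < count_list w True" for u
      using Cons.prems(3)[of "Suc u"] that True by (auto simp: w' \<open>x = y\<close>[symmetric])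
    from this[of 0] show ?thesis
      using that hd_count[of w True] hd_count[of v True] cT
      by (cases "count_list v True = 0") (auto simp: zero_in_down_levels)
  next
    case False
    have "u \<in> up_levels w \<longleftrightarrow> u \<in> up_levels v" if "u < count_list w False" for u
      using Cons.prems(4)[of "Suc u"] that False by (auto simp: w' \<open>x = y\<close>[symmetric])
    from this[of 0] show ?thesis
      using that hd_count[of w False] hd_count[of v False] cF
      by (cases "count_list v False = 0") (auto simp: zero_in_down_levels hd_map)
  qed
  have "w = v"
  proof (rule Cons.IH[OF cT cF])
    fix u assume u: "u < count_list w True"
    show "u \<in> down_levels w \<longleftrightarrow> u \<in> down_levels v"
    proof (cases "u = 0")
      case True
      have "w = [] \<longleftrightarrow> v = []" using len by (metis length_0_conv)
      then show ?thesis using hd True by (auto simp: zero_in_down_levels)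
    next
      case False
      then show ?thesis
        using Cons.prems(3)[of u] Cons.prems(3)[of "Suc u"] u
        by (cases x) (auto simp: w' \<open>x = y\<close>[symmetric])
    qed
  next
    fix u assume u: "u < count_list w False"
    show "u \<in> up_levels w \<longleftrightarrow> u \<in> up_levels v"
    proof (cases "u = 0")
      case True
      have "w = [] \<longleftrightarrow> v = []" using len by (metis length_0_conv)
      then show ?thesis using hd True by (auto simp: zero_in_down_levels hd_map)
    next
      case False
      then show ?thesis
        using Cons.prems(4)[of u] Cons.prems(4)[of "Suc u"] u
        by (cases x) (auto simp: w' \<open>x = y\<close>[symmetric])
    qed
  qed
  then show ?case by (simp add: w' \<open>x = y\<close>)
qed

section \<open>Checkmark representations in terms of words\<close>

text \<open>Level 0 of the up-steps is skipped because the start vertex is never a left turn; level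
  \<open>n\<close> is recorded in neither sequence.\<close>

definition level_marks :: "nat \<Rightarrow> bool list \<Rightarrow> mark list \<times> mark list" where
  "level_marks n w =
    (map (\<lambda>u. if u \<in> down_levels w then Arrow else Blank) [0..<n],
     map (\<lambda>u. if Suc u \<in> up_levels w then Arrow else Blank) [0..<n - 1])"

text \<open>Indices are 0-based, so even indices hold the odd-numbered letters; index
  \<open>2 * n - 1\<close>, the last letter, is left out.\<close>

definition word_marks :: "nat \<Rightarrow> bool list \<Rightarrow> mark list \<times> mark list" where
  "word_marks n w =
    (map (\<lambda>h. if w ! (2 * h) then Blank else Arrow) [0..<n],
     map (\<lambda>h. if w ! Suc (2 * h) then Arrow else Blank) [0..<n - 1])"

lemma right_turn_bits:
  assumes "p \<in> \<B> (2 * n)"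
  shows "right_turn n p i \<longleftrightarrow> i < 2 * n \<and> \<not> bits n p ! i \<and> (i = 0 \<or> bits n p ! (i - 1))"
  using down_step_bits[OF assms, of i] nth_bits[of "i - 1" n p]
  by (cases i) (auto simp: right_turn_def)

lemma left_turn_bits:
  assumes "p \<in> \<B> (2 * n)"
  shows "left_turn n p i \<longleftrightarrow> i < 2 * n \<and> bits n p ! i \<and> i \<noteq> 0 \<and> \<not> bits n p ! (i - 1)"
  using down_step_bits[OF assms, of "i - 1"] nth_bits[of i n p]
  by (cases i) (auto simp: left_turn_def)

lemma right_turn_level_iff:
  assumes "p \<in> \<B> (2 * n)"
  shows "(\<exists>i. right_turn n p i \<and> fst (p ! i) + snd (p ! i) = 2 * int u)
    \<longleftrightarrow> u \<in> down_levels (bits n p)"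
proof -
  have "fst (p ! i) + snd (p ! i) = 2 * int u \<longleftrightarrow> count_list (take i (bits n p)) True = u"
    if "i < 2 * n" for i
    using path_nth[OF assms, of i] that by auto
  then show ?thesis
    unfolding down_levels_turn_iff right_turn_bits[OF assms] by auto
qed

lemma left_turn_level_iff:
  assumes "p \<in> \<B> (2 * n)"
  shows "(\<exists>i. left_turn n p i \<and> fst (p ! i) - snd (p ! i) = 2 * int (Suc u))
    \<longleftrightarrow> Suc u \<in> up_levels (bits n p)"
proof -
  have eq: "fst (p ! i) - snd (p ! i) = 2 * int (Suc u) \<longleftrightarrow>
      count_list (take i (bits n p)) False = Suc u" if "i < 2 * n" for i
    using path_nth[OF assms, of i] that count_list_True_False[of "take i (bits n p)"] by auto
  \<comment> \<open>A positive level excludes the start vertex, which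
    \<open>down_levels_turn_iff\<close> admits as a turn but \<open>left_turn\<close> does
    not.\<close>
  have pos: "i \<noteq> 0" if "count_list (take i (bits n p)) False = Suc u" for i
    using that by (cases i) auto
  show ?thesis
    unfolding down_levels_turn_iff left_turn_bits[OF assms]
    by (rule ex_cong1) (auto simp: eq take_map count_list_map_Not simp del: of_nat_Suc dest: pos)
qed

lemma checkmark_rep_bits:
  assumes "p \<in> \<B> (2 * n)"
  shows "checkmark_rep n p = level_marks n (bits n p)"
  unfolding checkmark_rep_def level_marks_def prod.inject
  by (intro conjI nth_equalityI)
    (simp_all add: right_turn_level_iff[OF assms] left_turn_level_iff[OF assms, simplified]
      del: upt_Suc)

lemma phi_pair_bits: "phi_pair n p = word_marks n (bits n p)"
proof -
  have *: "path_word n p ! i = (if bits n p ! i then Arrow else Blank)" if "i < 2 * n" for i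
    using that by (simp add: path_word_def nth_bits del: upt_Suc)
  show ?thesis
    unfolding phi_pair_def word_marks_def Let_def prod.inject
    by (intro conjI nth_equalityI) (simp_all add: * del: upt_Suc)
qed

section \<open>The level marks inject balanced words into checkmark pairs\<close>

lemma count_fst_level_marks:
  "count_list (fst (level_marks n w)) Arrow = card (down_levels w \<inter> {..<n})"
  by (simp add: level_marks_def count_list_upt_sum Int_commute lessThan_atLeast0 sum_of_bool_eq)

lemma count_snd_level_marks:
  "count_list (snd (level_marks n w)) Arrow = card (up_levels w \<inter> {1..<n})"
proof -
  have "up_levels w \<inter> {1..<n} = Suc ` ({0..<n - 1} \<inter> {u. Suc u \<in> up_levels w})"
  proof (rule set_eqI)
    show "u \<in> up_levels w \<inter> {1..<n} \<longleftrightarrow>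
        u \<in> Suc ` ({0..<n - 1} \<inter> {u. Suc u \<in> up_levels w})" for u
      by (cases u) auto
  qed
  then show ?thesis
    by (simp add: level_marks_def count_list_upt_sum sum_of_bool_eq card_image)
qed

lemma card_split_top:
  assumes "A \<subseteq> {..n :: nat}"
  shows "card A = card (A \<inter> {..<n}) + of_bool (n \<in> A)"
proof -
  have "finite A" using assms finite_subset by blast
  moreover have "A \<inter> {..<n} = A - {n}" using assms by (auto simp: order_less_le)
  ultimately show ?thesis using card_Suc_Diff1[of A n] by auto
qed

text \<open>By \<open>card_down_levels\<close> the full level counts differ by one exactly when the
  last letter is down. Removing the top level, which belongs to the kind of the last letter, leaves
  an excess of one exactly when the last letter is up.\<close>

lemma checkmark_pair_level_marks:
  assumes "w \<in> balanced n" "n \<ge> 1"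
  shows "checkmark_pair n (level_marks n w)"
proof -
  have ct: "count_list w True = n" "count_list w False = n" "w \<noteq> []"
    using assms count_list_True_False[of w] by (auto simp: balanced_def)
  have down: "n \<in> down_levels w \<longleftrightarrow> \<not> last w" and up: "n \<in> up_levels w \<longleftrightarrow> last w"
    using count_in_down_levels[of w] count_in_up_levels[of w] ct by auto
  have "card (down_levels w) = card (down_levels w \<inter> {..<n}) + of_bool (n \<in> down_levels w)"
    using down_levels_le[of _ w] ct by (intro card_split_top) auto
  moreover have "card (up_levels w - {0}) =
      card ((up_levels w - {0}) \<inter> {..<n}) + of_bool (n \<in> up_levels w - {0})"
    using down_levels_le[of _ "map Not w"] ct by (intro card_split_top) (auto simp: count_list_map_Not)
  moreover have "(up_levels w - {0}) \<inter> {..<n} = up_levels w \<inter> {1..<n}"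
    by auto
  ultimately have "card (down_levels w \<inter> {..<n}) = card (up_levels w \<inter> {1..<n}) + of_bool (last w)"
    using card_down_levels[of w] ct(3) assms(2) down up by simp
  then show ?thesis
    unfolding checkmark_pair_def count_fst_level_marks count_snd_level_marks
    by (auto simp: level_marks_def)
qed

lemma inj_on_level_marks:
  assumes "n \<ge> 1"
  shows "inj_on (level_marks n) (balanced n)"
proof (rule inj_onI)
  fix w w' assume w: "w \<in> balanced n" "w' \<in> balanced n" and eq: "level_marks n w = level_marks n w'"
  have ct: "count_list w True = n" "count_list w False = n" "w \<noteq> []"
    "count_list w' True = n" "count_list w' False = n" "w' \<noteq> []"
    using assms w count_list_True_False[of w] count_list_True_False[of w'] by (auto simp: balanced_def)
  have down: "u \<in> down_levels w \<longleftrightarrow> u \<in> down_levels w'" if "u < n" for u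
    using eq that by (auto simp: level_marks_def split: if_splits)
  have "Suc u \<in> up_levels w \<longleftrightarrow> Suc u \<in> up_levels w'" if "Suc u < n" for u
    using eq that by (auto simp: level_marks_def split: if_splits)
  \<comment> \<open>The unrecorded level 0 of the up-steps is occupied exactly when level 0 of the
    down-steps is not.\<close>
  moreover have "0 \<in> up_levels w \<longleftrightarrow> 0 \<in> up_levels w'"
    using down[of 0] assms ct by (auto simp: zero_in_down_levels hd_map)
  ultimately have "u \<in> up_levels w \<longleftrightarrow> u \<in> up_levels w'" if "u < n" for u
    using that by (cases u) auto
  then show "w = w'"
    using down ct by (intro levels_determine_word) auto
qed

section \<open>Splitting balanced words by parity is a bijection onto checkmark pairs\<close>

lemma balanced_sum:
  assumes "w \<in> balanced n"
  shows "(\<Sum>h<n. of_bool (\<not> w ! (2 * h)) :: nat) = (\<Sum>h<n. of_bool (w ! Suc (2 * h)))"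
proof -
  \<comment> \<open>The \<open>n\<close> up-steps split by parity of position; below, the
    \<open>n\<close> odd-numbered letters split by direction. The odd-numbered up-steps
    cancel.\<close>
  have "(\<Sum>h<n. of_bool (w ! (2 * h))) + (\<Sum>h<n. of_bool (w ! Suc (2 * h))) = n"
  proof -
    have "length w = 2 * n" "count_list w True = n" using assms by (simp_all add: balanced_def)
    then show ?thesis
      using count_list_conv_sum[of w True] by (simp only: sum_lessThan_double) simp
  qed
  moreover have "(\<Sum>h<n. of_bool (w ! (2 * h))) + (\<Sum>h<n. of_bool (\<not> w ! (2 * h))) = n"
    by (rule sum_of_bool_add_Not)
  ultimately show ?thesis by linarith
qed

lemma count_fst_word_marks:
  "count_list (fst (word_marks n w)) Arrow = (\<Sum>h<n. of_bool (\<not> w ! (2 * h)))"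
  by (auto simp: word_marks_def count_list_upt_sum lessThan_atLeast0 intro!: sum.cong)

lemma count_snd_word_marks:
  "count_list (snd (word_marks n w)) Arrow = (\<Sum>h<n - 1. of_bool (w ! Suc (2 * h)))"
  by (auto simp: word_marks_def count_list_upt_sum lessThan_atLeast0 intro!: sum.cong)

text \<open>Dropping the last letter loses at most one even-numbered up-step, and by
  \<open>balanced_sum\<close> these are as many as the odd-numbered down-steps.\<close>

lemma checkmark_pair_word_marks:
  assumes "w \<in> balanced n" "n \<ge> 1"
  shows "checkmark_pair n (word_marks n w)"
proof -
  obtain k where "n = Suc k" using assms(2) by (cases n) auto
  then show ?thesis
    using balanced_sum[OF assms(1)]
    unfolding checkmark_pair_def count_fst_word_marks count_snd_word_marks
    by (auto simp: word_marks_def)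
qed

lemma inj_on_word_marks:
  assumes "n \<ge> 1"
  shows "inj_on (word_marks n) (balanced n)"
proof (rule inj_onI)
  fix w w' assume w: "w \<in> balanced n" "w' \<in> balanced n" and eq: "word_marks n w = word_marks n w'"
  have len: "length w = 2 * n" "length w' = 2 * n"
    using w by (auto simp: balanced_def)
  have even: "w ! (2 * h) = w' ! (2 * h)" if "h < n" for h
    using eq that by (auto simp: word_marks_def split: if_splits)
  have odd: "w ! Suc (2 * h) = w' ! Suc (2 * h)" if "h < n - 1" for h
    using eq that by (auto simp: word_marks_def split: if_splits)
  obtain k where n: "n = Suc k" using assms by (cases n) auto
  \<comment> \<open>Balance forces equal totals of even-numbered up-steps, so the omitted last
    letters agree too.\<close>
  have "(\<Sum>h<n. of_bool (w ! Suc (2 * h)) :: nat) = (\<Sum>h<n. of_bool (w' ! Suc (2 * h)))"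
    using balanced_sum[OF w(1)] balanced_sum[OF w(2)] even by simp
  then have last: "w ! Suc (2 * k) = w' ! Suc (2 * k)"
    using odd by (simp add: n of_bool_eq_iff)
  show "w = w'"
  proof (rule nth_equalityI)
    fix i assume "i < length w"
    define h where "h = i div 2"
    have "h < n" using \<open>i < length w\<close> len by (simp add: h_def)
    then have "h < n - 1 \<or> h = k" using n by auto
    moreover have "i = 2 * h \<or> i = Suc (2 * h)" unfolding h_def by presburger
    ultimately show "w ! i = w' ! i"
      using even[OF \<open>h < n\<close>] odd[of h] last by auto
  qed (simp add: len)
qed

lemma word_marks_surj:
  assumes "checkmark_pair n s" "n \<ge> 1"
  shows "s \<in> word_marks n ` balanced n"
proof -
  obtain k where n: "n = Suc k" using assms by (cases n) auto
  obtain t u where s: "s = (t, u)" by (cases s)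
  have len: "length t = n" "length u = n - 1"
    and ct: "count_list t Arrow = count_list u Arrow \<or> count_list t Arrow = count_list u Arrow + 1"
    using assms by (auto simp: checkmark_pair_def s)
  \<comment> \<open>The last letter is an up-step exactly when the first sequence has the extra
    arrow; this is what balance requires.\<close>
  define w where "w = map (\<lambda>i. if i = 2 * n - 1 then count_list t Arrow = count_list u Arrow + 1
    else if even i then t ! (i div 2) = Blank else u ! (i div 2) = Arrow) [0..<2 * n]"
  have even: "w ! (2 * h) \<longleftrightarrow> t ! h = Blank" if "h < n" for h
    using that n by (simp add: w_def del: upt_Suc)
  have odd: "w ! Suc (2 * h) \<longleftrightarrow> u ! h = Arrow" if "h < n - 1" for h
    using that n by (simp add: w_def del: upt_Suc)
  have last: "w ! Suc (2 * k) \<longleftrightarrow> count_list t Arrow = count_list u Arrow + 1"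
    using n by (simp add: w_def del: upt_Suc)
  have mark: "x \<noteq> Blank \<longleftrightarrow> x = Arrow" for x
    by (cases x) auto
  have marks: "word_marks n w = s"
    unfolding word_marks_def s prod.inject
    by (intro conjI nth_equalityI) (auto simp: len even odd mark, metis mark)
  have "count_list w True = (\<Sum>h<n. of_bool (w ! (2 * h))) + (\<Sum>h<n. of_bool (w ! Suc (2 * h)))"
    by (simp add: count_list_conv_sum sum_lessThan_double w_def del: upt_Suc)
  \<comment> \<open>The chosen last letter makes up the possible missing arrow of
    \<open>u\<close>.\<close>
  also have "(\<Sum>h<n. of_bool (w ! Suc (2 * h))) = count_list t Arrow"
    using count_snd_word_marks[of n w] ct last unfolding marks s by (auto simp: n)
  also have "\<dots> = (\<Sum>h<n. of_bool (\<not> w ! (2 * h)))"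
    using count_fst_word_marks[of n w] by (simp add: marks s)
  also have "(\<Sum>h<n. of_bool (w ! (2 * h))) + \<dots> = n"
    by (rule sum_of_bool_add_Not)
  finally have "w \<in> balanced n"
    by (simp add: balanced_def w_def)
  then show ?thesis using marks by blast
qed

lemma bij_betw_word_marks:
  "n \<ge> 1 \<Longrightarrow> bij_betw (word_marks n) (balanced n) (Collect (checkmark_pair n))"
  unfolding bij_betw_def
  using inj_on_word_marks checkmark_pair_word_marks word_marks_surj by blast

text \<open>No inverse is constructed: an injection into a finite set of the same size is onto, and
  \<open>word_marks\<close> supplies the size.\<close>

lemma bij_betw_level_marks:
  assumes "n \<ge> 1"
  shows "bij_betw (level_marks n) (balanced n) (Collect (checkmark_pair n))"
proof -
  have "card (level_marks n ` balanced n) = card (Collect (checkmark_pair n))"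
    using card_image[OF inj_on_level_marks[OF assms]] bij_betw_same_card[OF bij_betw_word_marks[OF assms]]
    by simp
  moreover have "finite (Collect (checkmark_pair n))"
    using bij_betw_finite[OF bij_betw_word_marks[OF assms]] finite_balanced by blast
  ultimately have "level_marks n ` balanced n = Collect (checkmark_pair n)"
    using checkmark_pair_level_marks assms by (intro card_subset_eq) auto
  then show ?thesis
    using inj_on_level_marks[OF assms] by (simp add: bij_betw_def)
qed

section \<open>Weights\<close>

lemma count_list_take_mono: "i \<le> j \<Longrightarrow> count_list (take i w) x \<le> count_list (take j w) x"
  by (auto simp: le_iff_add take_add)

text \<open>Peaks are counted by the number of up-steps before them: no two share a level, and level
  \<open>n\<close> always occurs in addition to the recorded ones.\<close>

lemma card_peaks:
  assumes "p \<in> \<B> (2 * n)" "n \<ge> 1"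
  shows "card {i. is_peak n p i} = card (down_levels (bits n p) \<inter> {..<n}) + 1"
proof -
  define w where "w = bits n p"
  define f where "f i = count_list (take i w) True" for i
  have w: "length w = 2 * n" "count_list w True = n" "w \<noteq> []"
    using bits_balanced[OF assms(1)] assms(2) by (auto simp: balanced_def w_def)
  \<comment> \<open>Both boundary conventions amount to an imaginary up-step before the path and an
    imaginary down-step after it.\<close>
  have peak: "is_peak n p i \<longleftrightarrow> i \<le> 2 * n \<and> (i = 0 \<or> w ! (i - 1)) \<and> (i = 2 * n \<or> \<not> w ! i)" for i
  proof (cases "0 < i \<and> i < 2 * n")
    case True
    then show ?thesis
      using down_step_bits[OF assms(1), of i] nth_bits[of "i - 1" n p]
      by (auto simp: is_peak_def w_def)
  next
    case False
    then show ?thesis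
      using down_step_bits[OF assms(1), of 0] nth_bits[of "2 * n - 1" n p] assms(2)
      by (auto simp: is_peak_def w_def)
  qed
  \<comment> \<open>Every peak but the start follows an up-step, so \<open>f\<close> jumps on
    reaching it.\<close>
  have inj: "inj_on f {i. is_peak n p i}"
  proof (rule linorder_inj_onI')
    fix i j assume j: "j \<in> {i. is_peak n p i}" and "i < j"
    then obtain k where k: "j = Suc k" by (cases j) auto
    have "f i \<le> f k" using \<open>i < j\<close> k by (simp add: f_def count_list_take_mono)
    also have "f k < f j" using j w k by (auto simp: f_def peak count_list_take_Suc)
    finally show "f i \<noteq> f j" by simp
  qed
  have "f ` {i. is_peak n p i} = insert n (down_levels w \<inter> {..<n})" (is "?A = ?B")
  proof
    show "?A \<subseteq> ?B"
    proof
      fix u assume "u \<in> ?A"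
      then obtain i where i: "is_peak n p i" "u = f i" by blast
      show "u \<in> ?B"
      proof (cases "i = 2 * n")
        case True
        then show ?thesis using i w by (simp add: f_def)
      next
        case False
        then have "u \<in> down_levels w"
          unfolding down_levels_iff w(1) using i by (intro exI[of _ i]) (auto simp: peak f_def)
        then show ?thesis using down_levels_le[of u w] w by auto
      qed
    qed
    have sub: "down_levels w \<subseteq> ?A"
    proof
      fix u assume "u \<in> down_levels w"
      then obtain i where "i < 2 * n" "\<not> w ! i" "i = 0 \<or> w ! (i - 1)" "f i = u"
        unfolding down_levels_turn_iff f_def w by blast
      then show "u \<in> ?A" using peak[of i] by force
    qed
    \<comment> \<open>Level \<open>n\<close> comes from the endpoint after a final up-step,
      otherwise from the turn opening the final down-run.\<close>
    have "n \<in> ?A"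
    proof (cases "last w")
      case True
      then have "is_peak n p (2 * n)" using w by (simp add: peak last_conv_nth)
      then show ?thesis using w by (intro image_eqI[of _ _ "2 * n"]) (auto simp: f_def)
    next
      case False
      then show ?thesis using sub count_in_down_levels[of w] w by auto
    qed
    then show "?B \<subseteq> ?A" using sub by blast
  qed
  then show ?thesis
    using card_image[OF inj] by (simp add: w_def)
qed

text \<open>Heights have the parity of the vertex index, so the weight depends only on the direction
  and position of the step.\<close>

lemma step_weight_bits:
  assumes "p \<in> \<B> (2 * n)" "i < 2 * n"
  shows "step_weight a b p (Suc i) = (if even i \<longleftrightarrow> bits n p ! i then a else b)"
proof -
  have "even (snd (p ! j)) \<longleftrightarrow> even j" if "j \<le> 2 * n" for j
    using path_nth[OF assms(1) that] by simp
  from this[of i] this[of "Suc i"] show ?thesis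
    using assms(2) down_step_bits[OF assms] nth_bits[OF assms(2), of p]
    by (auto simp: step_weight_def)
qed

text \<open>The outer indeterminate is b, so the degree counts steps of weight b: odd-numbered
  down-steps and even-numbered up-steps, equally many by balance.\<close>

lemma degree_bibanded_weight:
  assumes "p \<in> \<B> (2 * n)"
  shows "degree (bibanded_weight var_a var_b n p) = 2 * count_list (fst (phi_pair n p)) Arrow"
proof -
  have "bibanded_weight var_a var_b n p = (\<Prod>i<2 * n. step_weight var_a var_b p (Suc i))"
    unfolding bibanded_weight_def
    by (rule prod.reindex_bij_witness[of _ Suc "\<lambda>j. j - 1"]) auto
  also have "\<dots> = (\<Prod>i<2 * n. if even i \<longleftrightarrow> bits n p ! i then var_a else var_b)"
    by (intro prod.cong) (auto simp: step_weight_bits[OF assms])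
  also have "degree \<dots> = (\<Sum>i<2 * n. of_bool (even i \<longleftrightarrow> \<not> bits n p ! i))"
    by (subst degree_prod_sum_eq) (auto simp: var_a_def var_b_def intro!: sum.cong)
  also have "\<dots> = 2 * (\<Sum>h<n. of_bool (\<not> bits n p ! (2 * h)))"
    using balanced_sum[OF bits_balanced[OF assms]] by (simp add: sum_lessThan_double)
  finally show ?thesis
    by (simp add: phi_pair_bits count_fst_word_marks)
qed

lemma degree_monomial_ab: "degree (var_a ^ i * var_b ^ j) = j"
  by (simp add: degree_mult_eq degree_power_eq var_a_def var_b_def)

section \<open>Composing the bijections and comparing weights\<close>

theorem theorem1:
  fixes n :: nat
  assumes "n \<ge> 1"
  shows "(\<forall>p\<in>\<B> (2 * n). checkmark_pair n (phi_pair n p) \<and>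
            (\<exists>!q. q \<in> \<B> (2 * n) \<and> checkmark_rep n q = phi_pair n p)) \<and>
         bij_betw (phi n) (\<B> (2 * n)) (\<B> (2 * n)) \<and>
         (\<forall>p\<in>\<B> (2 * n). \<forall>v\<le>n.
            bibanded_weight var_a var_b n p = var_a ^ (2 * n - 2 * v) * var_b ^ (2 * v) \<longrightarrow>
            peak_weight var_m n (phi n p) = var_m ^ (v + 1))"
proof -
  let ?B = "\<B> (2 * n)" and ?C = "Collect (checkmark_pair n)"
  have pair: "bij_betw (phi_pair n) ?B ?C"
    using bij_betw_trans[OF bij_betw_bits bij_betw_word_marks[OF assms]]
    by (simp add: phi_pair_bits comp_def cong: bij_betw_cong)
  have rep: "bij_betw (checkmark_rep n) ?B ?C"
    using bij_betw_trans[OF bij_betw_bits bij_betw_level_marks[OF assms]]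
    by (simp add: checkmark_rep_bits cong: bij_betw_cong)
  have phi: "phi n p = inv_into ?B (checkmark_rep n) (phi_pair n p)"
    and unique: "\<exists>!q. q \<in> ?B \<and> checkmark_rep n q = phi_pair n p" if "p \<in> ?B" for p
  proof -
    have "phi_pair n p \<in> ?C" using pair that by (rule bij_betw_apply)
    then have q: "inv_into ?B (checkmark_rep n) (phi_pair n p) \<in> ?B"
      "checkmark_rep n (inv_into ?B (checkmark_rep n) (phi_pair n p)) = phi_pair n p"
      by (rule bij_betw_apply[OF bij_betw_inv_into[OF rep]], rule bij_betw_inv_into_right[OF rep])
    then show unique: "\<exists>!q. q \<in> ?B \<and> checkmark_rep n q = phi_pair n p"
      using inj_onD[OF bij_betw_imp_inj_on[OF rep]] by (intro ex1I) (blast, metis)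
    show "phi n p = inv_into ?B (checkmark_rep n) (phi_pair n p)"
      unfolding phi_def by (rule the1_equality[OF unique]) (use q in blast)
  qed
  have bij: "bij_betw (phi n) ?B ?B"
    using bij_betw_trans[OF pair bij_betw_inv_into[OF rep]] by (simp add: phi cong: bij_betw_cong)
  have "peak_weight var_m n (phi n p) = var_m ^ (v + 1)"
    if p: "p \<in> ?B"
      and v: "bibanded_weight var_a var_b n p = var_a ^ (2 * n - 2 * v) * var_b ^ (2 * v)" for p v
  proof -
    have q: "phi n p \<in> ?B" "checkmark_rep n (phi n p) = phi_pair n p"
      using theI'[OF unique[OF p]] by (simp_all add: phi_def)
    \<comment> \<open>Comparing degrees in b identifies \<open>v\<close>; the same arrows, read as
      level marks of \<open>phi n p\<close>, count its peaks up to one.\<close>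
    have "v = count_list (fst (phi_pair n p)) Arrow"
      using degree_bibanded_weight[OF p] by (simp add: v degree_monomial_ab)
    then show ?thesis
      using checkmark_rep_bits[OF q(1)] q(2) card_peaks[OF q(1) assms]
      by (simp add: peak_weight_def count_fst_level_marks)
  qed
  then show ?thesis
    using bij unique bij_betw_apply[OF pair] by blast
qed

end
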